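(* The quotient $\theta[1;\tfrac15]/\theta[1;\tfrac35]$ is given by a rational expression of four of the theta constants $\theta[\tfrac15;\tfrac k5]$, where $k=1,3,5,7,9$.
   Context: Let $\mathbb{H}^2=\{\tau\in\mathbb{C}:\Im\tau>0\}$. For $(\epsilon,\epsilon')\in\mathbb{R}^2$, $$\theta[\epsilon;\epsilon'](\zeta,\tau)=\sum_{n\in\mathbb{Z}}\exp\Big(2\pi i\Big[\tfrac12\big(n+\tfrac{\epsilon}{2}\big)^2\tau+\big(n+\tfrac{\epsilon}{2}\big)\big(\zeta+\tfrac{\epsilon'}{2}\big)\Big]\Big),$$ and the theta constant $\theta[\epsilon;\epsilon']=\theta[\epsilon;\epsilon'](0,\tau)$ is regarded as a holomorphic function of $\tau\in\mathbb{H}^2$. Rational expressions are with complex coefficients (involving $\zeta_5=e^{2\pi i/5}$), as identities of functions of $\tau$. *)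

theory Defs
  imports "HOL-Analysis.Analysis"
begin

definition upper_half_plane :: "complex set" where
  "upper_half_plane = {\<tau>. Im \<tau> > 0}"

definition theta_char :: "real \<Rightarrow> real \<Rightarrow> complex \<Rightarrow> complex \<Rightarrow> complex" where
  "theta_char e e' \<zeta> \<tau> =
     (\<Sum>\<^sub>\<infinity>n::int. exp (2 * pi * \<i> *
        (of_real ((real_of_int n + e / 2)^2 / 2) * \<tau>
         + of_real (real_of_int n + e / 2) * (\<zeta> + of_real (e' / 2)))))"

definition theta_const :: "real \<Rightarrow> real \<Rightarrow> complex \<Rightarrow> complex" where
  "theta_const e e' \<tau> = theta_char e e' 0 \<tau>"

text \<open>A polynomial with complex coefficients in the variables indexed by a finite set K
  is given by a finitely supported coefficient function on exponent vectors
  (monomials), the exponent vectors vanishing outside K.\<close>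
definition is_poly_in :: "'i set \<Rightarrow> (('i \<Rightarrow> nat) \<Rightarrow> complex) \<Rightarrow> bool" where
  "is_poly_in K c \<longleftrightarrow> finite {m. c m \<noteq> 0} \<and> (\<forall>m. c m \<noteq> 0 \<longrightarrow> (\<forall>k. k \<notin> K \<longrightarrow> m k = 0))"

definition poly_eval :: "'i set \<Rightarrow> (('i \<Rightarrow> nat) \<Rightarrow> complex) \<Rightarrow> ('i \<Rightarrow> complex) \<Rightarrow> complex" where
  "poly_eval K c x = (\<Sum>m\<in>{m. c m \<noteq> 0}. c m * (\<Prod>k\<in>K. x k ^ m k))"

end

theory Submission
  imports Defs
begin

text \<open>
  Write f(a) for the theta constant with characteristics (1/5, a), v and u for those with
  characteristics (1, 1/5) and (1, 3/5). A product f(c + d) f(c - d) is a scalar product of a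
  vector depending on c and a vector depending on d whose entries are theta constants at
  2 tau. Since any three vectors in the plane are linearly dependent, d = 0, 2/5, 4/5 give
  v^2 f(c + 2/5) f(c - 2/5) - u v f(c)^2 - u^2 f(c + 4/5) f(c - 4/5) = 0.
  Eliminating f(9/5) between the cases c = 1 and c = 3/5 leaves a multiple of v,
  and dividing by it gives the quotient v / u.
\<close>

section \<open>Convergence of the theta series\<close>

text \<open>The summand 0 in \<open>0 + of_real (e' / 2)\<close> keeps the literal shape of the
  series at \<zeta> = 0.\<close>

definition theta_term :: "real \<Rightarrow> real \<Rightarrow> complex \<Rightarrow> int \<Rightarrow> complex" where
  "theta_term e e' \<tau> n = exp (2 * pi * \<i> *
        (of_real ((real_of_int n + e / 2)^2 / 2) * \<tau>
         + of_real (real_of_int n + e / 2) * (0 + of_real (e' / 2))))"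

lemma theta_const_eq_infsum: "theta_const e e' \<tau> = (\<Sum>\<^sub>\<infinity>n. theta_term e e' \<tau> n)"
  unfolding theta_const_def theta_char_def theta_term_def ..

lemma norm_theta_term:
  "norm (theta_term e e' \<tau> n) = exp (- pi * Im \<tau> * (real_of_int n + e / 2)^2)"
  unfolding theta_term_def norm_exp_eq_Re by simp

lemma summable_on_power_abs_int:
  fixes r :: real
  assumes "0 \<le> r" "r < 1"
  shows "(\<lambda>n::int. r ^ nat \<bar>n\<bar>) summable_on UNIV"
proof -
  have s: "(\<lambda>n::nat. r ^ n) summable_on UNIV"
    using assms by (intro norm_summable_imp_summable_on) (simp add: summable_geometric)
  have nn: "(\<lambda>n::int. r ^ nat \<bar>n\<bar>) summable_on range int"
    using s by (subst summable_on_reindex) (auto simp: o_def)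
  have np: "(\<lambda>n::int. r ^ nat \<bar>n\<bar>) summable_on range (\<lambda>k. - int k)"
    using s by (subst summable_on_reindex) (auto simp: o_def inj_on_def)
  have "(UNIV::int set) = range int \<union> range (\<lambda>k. - int k)"
  proof -
    have "n \<in> range int \<union> range (\<lambda>k. - int k)" for n :: int
      by (cases n rule: int_cases2) auto
    then show ?thesis by auto
  qed
  then show ?thesis using summable_on_union[OF nn np] by simp
qed

lemma abs_le_square_int: "\<bar>n\<bar> \<le> n ^ 2" for n :: int
proof (cases "n = 0")
  case False
  then have "1 * \<bar>n\<bar> \<le> \<bar>n\<bar> * \<bar>n\<bar>" by (intro mult_right_mono) auto
  then show ?thesis by (simp add: power2_eq_square)
qed simp

lemma theta_term_abs_summable:
  assumes "Im \<tau> > 0"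
  shows "(\<lambda>n. norm (theta_term e e' \<tau> n)) summable_on UNIV"
proof -
  define y a where "y = pi * Im \<tau>" and "a = e / 2"
  have y: "y > 0" using assms by (simp add: y_def)
  have "norm (theta_term e e' \<tau> n) \<le> exp (y * a^2) * exp (- y / 2) ^ nat \<bar>n\<bar>" for n
  proof -
    have "real_of_int n ^ 2 \<ge> real_of_int \<bar>n\<bar>"
      using abs_le_square_int[of n] by (metis of_int_le_iff of_int_power)
    \<comment> \<open>Completing the square gives (n + a)^2 \<ge> n^2/2 - a^2, so the Gaussian decay
      of the terms beats a geometric series in |n|.\<close>
    moreover have "2 * (real_of_int n + a)^2 - real_of_int n ^ 2 + 2 * a^2 = (real_of_int n + 2 * a)^2"
      by (simp add: power2_eq_square algebra_simps)
    ultimately have "(real_of_int n + a)^2 \<ge> real_of_int \<bar>n\<bar> / 2 - a^2"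
      using zero_le_power2[of "real_of_int n + 2 * a"] by linarith
    then have "y * (real_of_int n + a)^2 \<ge> y * (real_of_int \<bar>n\<bar> / 2 - a^2)"
      using y by simp
    then have "exp (- (y * (real_of_int n + a)^2)) \<le> exp (y * a^2 + real (nat \<bar>n\<bar>) * (- y / 2))"
      by (simp add: algebra_simps)
    then show ?thesis
      unfolding norm_theta_term exp_add exp_of_nat_mult by (simp add: y_def a_def)
  qed
  note bound = this
  have "(\<lambda>n::int. exp (y * a^2) * exp (- y / 2) ^ nat \<bar>n\<bar>) summable_on UNIV"
    using y by (intro summable_on_cmult_right summable_on_power_abs_int) auto
  then show ?thesis
    by (rule summable_on_comparison_test) (use bound in auto)
qed

lemma theta_term_summable:
  "Im \<tau> > 0 \<Longrightarrow> theta_term e e' \<tau> summable_on UNIV"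
  by (rule abs_summable_summable[OF theta_term_abs_summable])

section \<open>Products of two theta constants\<close>

text \<open>Put X = i + (r + e)/2 and Y = j + r/2. The shifted indices on the left are X + Y and X -
  Y, the sum of their squares is 2 X^2 + 2 Y^2, and the factor 2 moves into the modulus 2
  \<tau>.\<close>

lemma theta_term_mult:
  "theta_term e a \<tau> (i + j + r) * theta_term e b \<tau> (i - j) =
    theta_term (of_int r + e) (a + b) (2 * \<tau>) i * theta_term (of_int r) (a - b) (2 * \<tau>) j"
  unfolding theta_term_def exp_add[symmetric]
  by (rule arg_cong[where f = exp]) (simp add: field_simps power2_eq_square)

lemma infsum_mult_abs_summable:
  fixes f :: "'a \<Rightarrow> complex" and g :: "'b \<Rightarrow> complex"
  assumes "(\<lambda>x. norm (f x)) summable_on A" "(\<lambda>y. norm (g y)) summable_on B"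
  shows "(\<lambda>(x, y). f x * g y) summable_on A \<times> B"
    and "infsum f A * infsum g B = (\<Sum>\<^sub>\<infinity>(x, y)\<in>A \<times> B. f x * g y)"
proof -
  have "(\<lambda>p. norm (case p of (x, y) \<Rightarrow> f x * g y)) summable_on A \<times> B"
    unfolding Infinite_Sum.abs_summable_on_Sigma_iff
  proof (intro conjI ballI)
    show "(\<lambda>y. norm (case (x, y) of (x, y) \<Rightarrow> f x * g y)) summable_on B" for x
      using summable_on_cmult_right[OF assms(2), of "norm (f x)"] by (simp add: norm_mult)
    have "norm (\<Sum>\<^sub>\<infinity>y\<in>B. norm (case (x, y) of (x, y) \<Rightarrow> f x * g y)) =
        norm (f x) * (\<Sum>\<^sub>\<infinity>y\<in>B. norm (g y))" for x
      using infsum_nonneg[of B "\<lambda>y. norm (g y)"] by (simp add: norm_mult infsum_cmult_right' abs_mult)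
    then show "(\<lambda>x. norm (\<Sum>\<^sub>\<infinity>y\<in>B. norm (case (x, y) of (x, y) \<Rightarrow> f x * g y))) summable_on A"
      using summable_on_cmult_left[OF assms(1)] by simp
  qed
  then show *: "(\<lambda>(x, y). f x * g y) summable_on A \<times> B"
    by (rule abs_summable_summable)
  show "infsum f A * infsum g B = (\<Sum>\<^sub>\<infinity>(x, y)\<in>A \<times> B. f x * g y)"
    by (simp add: infsum_Sigma'_banach[OF *, symmetric] infsum_cmult_right' infsum_cmult_left')
qed

text \<open>The double series over (m, n) is split by the parity r of m + n. On each class
  \<open>theta_term_mult\<close> separates the variables, so each r contributes a product of two
  theta constants at 2 \<tau>.\<close>

lemma theta_const_mult:
  assumes "Im \<tau> > 0"
  shows "theta_const e a \<tau> * theta_const e b \<tau> =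
    theta_const e (a + b) (2 * \<tau>) * theta_const 0 (a - b) (2 * \<tau>) +
    theta_const (1 + e) (a + b) (2 * \<tau>) * theta_const 1 (a - b) (2 * \<tau>)"
proof -
  have im2: "Im (2 * \<tau>) > 0" using assms by simp
  define F where "F = (\<lambda>(m, n). theta_term e a \<tau> m * theta_term e b \<tau> n)"
  define \<phi> :: "int \<times> int \<times> int \<Rightarrow> int \<times> int" where "\<phi> = (\<lambda>(r, i, j). (i + j + r, i - j))"
  note F = infsum_mult_abs_summable[OF theta_term_abs_summable[OF assms, of e a]
      theta_term_abs_summable[OF assms, of e b], folded F_def]
  have bij: "bij_betw \<phi> ({0, 1} \<times> UNIV) UNIV"
  \<comment> \<open>Here m + n = 2 i + r and m - n = 2 j + r, so rounding down in \<open>div\<close>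
    removes r from both.\<close>
  proof (rule bij_betwI[of _ _ _ "\<lambda>(m, n). ((m + n) mod 2, (m + n) div 2, (m - n) div 2)"])
    show "(case \<phi> x of (m, n) \<Rightarrow> ((m + n) mod 2, (m + n) div 2, (m - n) div 2)) = x"
      if "x \<in> {0, 1} \<times> UNIV" for x
      using that by (auto simp: \<phi>_def; presburger)
    show "\<phi> (case y of (m, n) \<Rightarrow> ((m + n) mod 2, (m + n) div 2, (m - n) div 2)) = y" for y
      by (cases y) (simp add: \<phi>_def; presburger)
  qed auto
  have inner: "(\<Sum>\<^sub>\<infinity>p. F (\<phi> (r, p))) =
      theta_const (of_int r + e) (a + b) (2 * \<tau>) * theta_const (of_int r) (a - b) (2 * \<tau>)" for r
    unfolding theta_const_eq_infsum
    by (subst infsum_mult_abs_summable(2))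
      (simp_all add: theta_term_abs_summable[OF im2] F_def \<phi>_def theta_term_mult case_prod_unfold)
  have "theta_const e a \<tau> * theta_const e b \<tau> = infsum F UNIV"
    unfolding theta_const_eq_infsum F(2) by simp
  also have "\<dots> = (\<Sum>\<^sub>\<infinity>x\<in>{0, 1} \<times> UNIV. F (\<phi> x))"
    by (rule infsum_reindex_bij_betw[OF bij, symmetric])
  also have "\<dots> = (\<Sum>\<^sub>\<infinity>r\<in>{0, 1}. \<Sum>\<^sub>\<infinity>p. F (\<phi> (r, p)))"
    using F(1) by (subst infsum_Sigma_banach) (simp_all add: summable_on_reindex_bij_betw[OF bij])
  finally show ?thesis
    by (simp add: inner)
qed

section \<open>Symmetry and quasi-periodicity in the characteristics\<close>

lemma theta_const_char_add_2: "theta_const (e + 2) a \<tau> = theta_const e a \<tau>"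
proof -
  have "theta_term (e + 2) a \<tau> n = theta_term e a \<tau> (n + 1)" for n
    unfolding theta_term_def by (rule arg_cong[where f = exp]) (simp add: field_simps power2_eq_square)
  then have "theta_const (e + 2) a \<tau> = (\<Sum>\<^sub>\<infinity>n. theta_term e a \<tau> (n + 1))"
    by (simp add: theta_const_eq_infsum)
  also have "\<dots> = theta_const e a \<tau>"
    unfolding theta_const_eq_infsum
    by (rule infsum_reindex_bij_betw[of "\<lambda>n. n + 1"]) (rule bij_betwI[of _ _ _ "\<lambda>n. n - 1"], auto)
  finally show ?thesis .
qed

lemma theta_const_uminus: "theta_const (- e) (- a) \<tau> = theta_const e a \<tau>"
proof -
  have "theta_term (- e) (- a) \<tau> n = theta_term e a \<tau> (- n)" for n
    unfolding theta_term_def by (rule arg_cong[where f = exp]) (simp add: field_simps power2_eq_square)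
  then have "theta_const (- e) (- a) \<tau> = (\<Sum>\<^sub>\<infinity>n. theta_term e a \<tau> (- n))"
    by (simp add: theta_const_eq_infsum)
  also have "\<dots> = theta_const e a \<tau>"
    unfolding theta_const_eq_infsum
    by (rule infsum_reindex_bij_betw[of "\<lambda>n. - n"]) (rule bij_betwI[of _ _ _ "\<lambda>n. - n"], auto)
  finally show ?thesis .
qed

lemma theta_const_add_2: "theta_const e (a + 2) \<tau> = exp (pi * \<i> * e) * theta_const e a \<tau>"
proof -
  have "theta_term e (a + 2) \<tau> n = exp (pi * \<i> * e) * theta_term e a \<tau> n" for n
  proof -
    have "theta_term e (a + 2) \<tau> n = exp (pi * \<i> * e) * theta_term e a \<tau> n * exp (2 * pi * \<i> * of_int n)"
      unfolding theta_term_def exp_add[symmetric]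
      by (rule arg_cong[where f = exp]) (simp add: field_simps power2_eq_square)
    moreover have "exp (2 * pi * \<i> * of_int n) = 1"
      using exp_integer_2pi[of "of_int n"] by (simp add: mult_ac)
    ultimately show ?thesis by simp
  qed
  then show ?thesis by (simp add: theta_const_eq_infsum infsum_cmult_right')
qed

lemma theta_const_0_add_2: "theta_const 0 (a + 2) \<tau> = theta_const 0 a \<tau>"
  by (simp add: theta_const_add_2)

lemma theta_const_1_add_2: "theta_const 1 (a + 2) \<tau> = - theta_const 1 a \<tau>"
  by (simp add: theta_const_add_2)

lemma theta_const_1_uminus: "theta_const 1 (- a) \<tau> = theta_const 1 a \<tau>"
  using theta_const_uminus[of 1 a \<tau>] theta_const_char_add_2[of "-1" "-a" \<tau>] by simp

section \<open>Quadratic relations and the elimination\<close>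

lemma theta_const_1_mult:
  assumes "Im \<tau> > 0"
  shows "theta_const 1 a \<tau> * theta_const 1 b \<tau> =
    theta_const 1 (a + b) (2 * \<tau>) * theta_const 0 (a - b) (2 * \<tau>) +
    theta_const 0 (a + b) (2 * \<tau>) * theta_const 1 (a - b) (2 * \<tau>)"
  using theta_const_mult[OF assms, of 1 a b] theta_const_char_add_2[of 0 "a + b" "2 * \<tau>"] by simp

text \<open>The characteristic e and the centre c enter only through the vector (\<open>p0\<close>,
  \<open>p1\<close>). The coefficients depend on the other three vectors alone, so they are the same
  for every c.\<close>

lemma theta_const_quadratic_relation:
  assumes "Im \<tau> > 0"
  shows "theta_const 1 (1/5) \<tau> ^ 2 * (theta_const e (c + 2/5) \<tau> * theta_const e (c - 2/5) \<tau>)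
    - theta_const 1 (1/5) \<tau> * theta_const 1 (3/5) \<tau> * theta_const e c \<tau> ^ 2
    - theta_const 1 (3/5) \<tau> ^ 2 * (theta_const e (c + 4/5) \<tau> * theta_const e (c - 4/5) \<tau>) = 0"
proof -
  define p0 p1 where "p0 = theta_const e (2 * c) (2 * \<tau>)" and "p1 = theta_const (1 + e) (2 * c) (2 * \<tau>)"
  define q0 q1 where "q0 d = theta_const 0 d (2 * \<tau>)" and "q1 d = theta_const 1 d (2 * \<tau>)" for d
  have f: "theta_const e (c + d) \<tau> * theta_const e (c - d) \<tau> = p0 * q0 (2 * d) + p1 * q1 (2 * d)" for d
    using theta_const_mult[OF assms, of e "c + d" "c - d"] by (simp add: p0_def p1_def q0_def q1_def)
  have f0: "theta_const e c \<tau> ^ 2 = p0 * q0 0 + p1 * q1 0"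
    using f[of 0] by (simp add: power2_eq_square)
  have g: "theta_const 1 a \<tau> * theta_const 1 b \<tau> = q0 (a - b) * q1 (a + b) + q1 (a - b) * q0 (a + b)" for a b
    using theta_const_1_mult[OF assms, of a b] by (simp add: q0_def q1_def)
  have per: "q0 (d + 2) = q0 d" "q1 (d + 2) = - q1 d" for d
    by (simp_all add: q0_def q1_def theta_const_0_add_2 theta_const_1_add_2)
  \<comment> \<open>The pairs (7/5, 3/5), (9/5, 1/5), (11/5, 3/5) have sums 2, 2, 14/5 and
    differences 4/5, 8/5, 8/5. Modulo 2 these are exactly the arguments 0, 4/5, 8/5 of the three
    vectors.\<close>
  have h: "theta_const 1 (7/5) \<tau> = - theta_const 1 (3/5) \<tau>"
       "theta_const 1 (9/5) \<tau> = - theta_const 1 (1/5) \<tau>"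
       "theta_const 1 (11/5) \<tau> = - theta_const 1 (1/5) \<tau>"
    using theta_const_1_add_2[of "-(3/5)" \<tau>] theta_const_1_add_2[of "-(1/5)" \<tau>]
      theta_const_1_add_2[of "1/5" \<tau>] by (simp_all only: theta_const_1_uminus) simp_all
  \<comment> \<open>The three 2x2 minors of the vectors (q0 d, q1 d) for d = 0, 4/5, 8/5; the final identity is their
    Pluecker relation. The periodicity of q0 and q1 turns the plus sign in g into a minus sign.\<close>
  have uu: "theta_const 1 (3/5) \<tau> ^ 2 = q1 0 * q0 (4/5) - q0 0 * q1 (4/5)"
    using g[of "7/5" "3/5"] per[of 0] unfolding h by (simp add: power2_eq_square) algebra
  have vv: "theta_const 1 (1/5) \<tau> ^ 2 = q1 0 * q0 (8/5) - q0 0 * q1 (8/5)"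
    using g[of "9/5" "1/5"] per[of 0] unfolding h by (simp add: power2_eq_square) algebra
  have uv: "theta_const 1 (1/5) \<tau> * theta_const 1 (3/5) \<tau> = q1 (4/5) * q0 (8/5) - q0 (4/5) * q1 (8/5)"
    using g[of "11/5" "3/5"] per[of "4/5"] unfolding h by simp algebra
  show ?thesis
    unfolding f f0 uu vv uv by (simp add: algebra_simps)
qed


lemma theta_const_quotient_relation:
  assumes "Im \<tau> > 0"
  defines "f \<equiv> \<lambda>k::nat. theta_const (1/5) (real k / 5) \<tau>"
    and "\<kappa> \<equiv> exp (- (pi * \<i> / 5))"
  shows "theta_const 1 (1/5) \<tau> * (\<kappa> * f 3 * f 7 ^ 2 - f 1 ^ 2 * f 5) =
    theta_const 1 (3/5) \<tau> * (\<kappa> * f 5 ^ 2 * f 7 - f 1 * f 3 ^ 2)"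
proof -
  define u v where "u = theta_const 1 (3/5) \<tau>" and "v = theta_const 1 (1/5) \<tau>"
  define F where "F a = theta_const (1/5) a \<tau>" for a
  \<comment> \<open>The case c = 3/5 involves the value at -1/5. Moving it to 9/5 makes it share its
    unknown with the case c = 1, and this is where \<kappa> comes from.\<close>
  have F9: "F (- (1/5)) = \<kappa> * F (9/5)"
    using theta_const_add_2[of "1/5" "- (1/5)" \<tau>]
    by (simp add: F_def \<kappa>_def exp_minus field_simps)
  have rel: "v ^ 2 * (F (c + 2/5) * F (c - 2/5)) - v * u * F c ^ 2 - u ^ 2 * (F (c + 4/5) * F (c - 4/5)) = 0" for c
    unfolding u_def v_def F_def by (rule theta_const_quadratic_relation[OF assms(1)])
  have f: "f 1 = F (1/5)" "f 3 = F (3/5)" "f 5 = F 1" "f 7 = F (7/5)"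
    by (simp_all add: f_def F_def)
  have r1: "v ^ 2 * (f 7 * f 3) - v * u * f 5 ^ 2 - u ^ 2 * (F (9/5) * f 1) = 0"
    using rel[of 1] by (simp add: f del: One_nat_def)
  have r3: "v ^ 2 * (f 5 * f 1) - v * u * f 3 ^ 2 - u ^ 2 * (f 7 * (\<kappa> * F (9/5))) = 0"
    using rel[of "3/5"] F9 by (simp add: f del: One_nat_def)
  \<comment> \<open>In \<kappa> * f 7 times \<open>r1\<close> minus f 1 times \<open>r3\<close> the
    terms with F (9/5) cancel, and every remaining term contains v.\<close>
  have "v * (v * (\<kappa> * f 3 * f 7 ^ 2 - f 1 ^ 2 * f 5) - u * (\<kappa> * f 5 ^ 2 * f 7 - f 1 * f 3 ^ 2)) = 0"
    using r1 r3 by algebra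
  \<comment> \<open>Avoids proving that v has no zeros: where v vanishes, the relations for c = 1/5 and c = 7/5
    make both terms of the numerator vanish, unless u = 0.\<close>
  moreover have "u * (\<kappa> * f 5 ^ 2 * f 7 - f 1 * f 3 ^ 2) = 0" if "v = 0"
  proof -
    have "u = 0 \<or> f 5 = 0 \<or> F (- (3/5)) = 0" using rel[of "1/5"] that by (simp add: f del: One_nat_def)
    moreover have "u = 0 \<or> f 3 = 0 \<or> F (11/5) = 0" using rel[of "7/5"] that by (auto simp: f simp del: One_nat_def)
    moreover have "F (7/5) = exp (pi * \<i> / 5) * F (- (3/5))" "F (11/5) = exp (pi * \<i> / 5) * F (1/5)"
      using theta_const_add_2[of "1/5" "- (3/5)" \<tau>] theta_const_add_2[of "1/5" "1/5" \<tau>]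
      by (simp_all add: F_def)
    ultimately show ?thesis by (auto simp: f simp del: One_nat_def)
  qed
  ultimately show ?thesis unfolding u_def v_def by auto
qed

section \<open>Asymptotics on the imaginary axis and the nonzero denominator\<close>

lemma exp_linear_tendsto_0:
  fixes c :: real
  assumes "c < 0"
  shows "((\<lambda>t. exp (c * t)) \<longlongrightarrow> 0) at_top"
  by (rule filterlim_compose[OF exp_at_bot
        filterlim_tendsto_neg_mult_at_bot[OF tendsto_const assms filterlim_ident]])

text \<open>At \<tau> = i t the term of index n has size exp(- \<pi> t (n + 1/10)^2). The largest is
  n = 0 and the next is n = -1, smaller by exp(- \<pi> t (81 - 1)/100) and with relative phase exp(-
  \<pi> i k/5).\<close>

lemma theta_const_expansion:
  fixes k :: real
  defines "A \<equiv> \<lambda>t. theta_term (1/5) (k/5) (\<i> * of_real t)"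
  shows "((\<lambda>t. (theta_const (1/5) (k/5) (\<i> * of_real t) / A t 0 - 1) / of_real (exp (- 4 * pi * t / 5)))
    \<longlongrightarrow> exp (- (pi * \<i> * k / 5))) at_top"
proof -
  define s :: "real \<Rightarrow> real" where "s t = exp (- pi * t / 100)" for t
  define B where "B t n = A t n / (A t 0 * of_real (exp (- 4 * pi * t / 5)))" for t n
  define C where "C = (\<Sum>\<^sub>\<infinity>n::int. (1/2::real) ^ nat \<bar>n\<bar>)"
  \<comment> \<open>\<open>B\<close> is normalised by the size of the term n = -1, whence 81 = (10 *
    (-1) + 1)^2.\<close>
  have B_norm: "norm (B t n) = exp (- pi * t * ((10 * n + 1) ^ 2 - 81) / 100)" for t n
    unfolding B_def A_def norm_divide norm_mult norm_theta_term norm_of_real abs_exp_cancel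
      exp_diff[symmetric] exp_add[symmetric]
    by (rule arg_cong[where f = exp]) (simp add: field_simps power2_eq_square)
  have s_lim: "(s \<longlongrightarrow> 0) at_top"
    using exp_linear_tendsto_0[of "- pi / 100"] by (simp add: s_def[abs_def])
  have s_nonneg: "s t \<ge> 0" for t by (simp add: s_def)
  have tail: "norm (\<Sum>\<^sub>\<infinity>n\<in>- {0, -1}. B t n) \<le> s t * C" if "t > 0" "s t \<le> 1/2" for t
  proof -
    have bound: "norm (B t n) \<le> s t * (1/2) ^ nat \<bar>n\<bar>" if n: "n \<in> - {0, -1}" for n
    proof -
      \<comment> \<open>The part |n| of the bound yields a geometric series, and the extra 1 leaves
        a factor \<open>s t\<close> that sends the whole tail to 0.\<close>
      have "1 + \<bar>n\<bar> \<le> (10 * n + 1) ^ 2 - 81"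
      proof -
        have "n \<ge> 1 \<or> n \<le> - 2" using n by auto
        \<comment> \<open>The product is negative exactly at the two excluded indices 0 and
          -1.\<close>
        then have "(n - 1) * (n + 2) \<ge> 0" by (auto simp: zero_le_mult_iff)
        then have "n ^ 2 + n \<ge> 2" by (simp add: power2_eq_square algebra_simps)
        moreover have "(10 * n + 1) ^ 2 - 81 = 100 * n ^ 2 + 20 * n - 80"
          by (simp add: power2_eq_square algebra_simps)
        ultimately show ?thesis using abs_le_square_int[of n] by linarith
      qed
      then have "real_of_int (1 + \<bar>n\<bar>) \<le> real_of_int ((10 * n + 1) ^ 2 - 81)"
        by (simp only: of_int_le_iff)
      then have "pi * t / 100 * (1 + nat \<bar>n\<bar>) \<le> pi * t / 100 * ((10 * n + 1) ^ 2 - 81)"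
        using \<open>t > 0\<close> by (intro mult_left_mono) auto
      then have "norm (B t n) \<le> exp (real (1 + nat \<bar>n\<bar>) * (- pi * t / 100))"
        unfolding B_norm by (simp add: field_simps)
      also have "\<dots> = s t * s t ^ nat \<bar>n\<bar>"
        unfolding exp_of_nat_mult s_def by simp
      also have "\<dots> \<le> s t * (1/2) ^ nat \<bar>n\<bar>"
        using \<open>s t \<le> 1/2\<close> by (intro mult_left_mono power_mono) (auto simp: s_def)
      finally show ?thesis .
    qed
    have sum: "(\<lambda>n::int. s t * (1/2) ^ nat \<bar>n\<bar>) summable_on X" for X
      by (rule summable_on_subset_banach[of _ UNIV])
        (auto intro!: summable_on_cmult_right summable_on_power_abs_int)
    have "norm (\<Sum>\<^sub>\<infinity>n\<in>- {0, -1}. B t n) \<le> (\<Sum>\<^sub>\<infinity>n\<in>- {0, -1}. s t * (1/2) ^ nat \<bar>n\<bar>)"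
      by (rule norm_infsum_le[OF has_sum_infsum has_sum_infsum])
        (auto intro!: sum bound abs_summable_summable[OF summable_on_comparison_test[OF sum]])
    also have "\<dots> \<le> (\<Sum>\<^sub>\<infinity>n. s t * (1/2) ^ nat \<bar>n\<bar>)"
      by (rule infsum_mono_neutral) (auto intro!: sum simp: s_nonneg)
    finally show ?thesis by (simp add: C_def infsum_cmult_right')
  qed
  have "((\<lambda>t. \<Sum>\<^sub>\<infinity>n\<in>- {0, -1}. B t n) \<longlongrightarrow> 0) at_top"
  proof (rule Lim_null_comparison)
    show "\<forall>\<^sub>F t in at_top. norm (\<Sum>\<^sub>\<infinity>n\<in>- {0, -1}. B t n) \<le> s t * C"
      using eventually_gt_at_top[of 0] order_tendstoD(2)[OF s_lim, of "1/2", simplified]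
      by eventually_elim (rule tail, auto)
    show "((\<lambda>t. s t * C) \<longlongrightarrow> 0) at_top"
      using tendsto_mult_left_zero[OF s_lim] .
  qed
  then have "((\<lambda>t. exp (- (pi * \<i> * k / 5)) + (\<Sum>\<^sub>\<infinity>n\<in>- {0, -1}. B t n)) \<longlongrightarrow> exp (- (pi * \<i> * k / 5)) + 0) at_top"
    by (intro tendsto_add tendsto_const)
  moreover have "\<forall>\<^sub>F t in at_top. exp (- (pi * \<i> * k / 5)) + (\<Sum>\<^sub>\<infinity>n\<in>- {0, -1}. B t n) =
      (theta_const (1/5) (k/5) (\<i> * of_real t) / A t 0 - 1) / of_real (exp (- 4 * pi * t / 5))"
    using eventually_gt_at_top[of 0]
  proof eventually_elim
    case (elim t)
    have nz: "A t 0 \<noteq> 0" by (simp add: A_def theta_term_def)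
    have sumA: "A t summable_on X" for X
      unfolding A_def using elim
      by (intro summable_on_subset_banach[OF theta_term_summable]) auto
    have "theta_const (1/5) (k/5) (\<i> * of_real t) = infsum (A t) ({0, -1} \<union> - {0, -1})"
      by (simp add: theta_const_eq_infsum A_def)
    also have "\<dots> = A t 0 + A t (-1) + infsum (A t) (- {0, -1})"
      by (subst infsum_Un_disjoint) (auto intro: sumA)
    also have "A t (-1) = A t 0 * of_real (exp (- 4 * pi * t / 5)) * exp (- (pi * \<i> * k / 5))"
      unfolding A_def theta_term_def exp_of_real[symmetric] exp_add[symmetric]
      by (rule arg_cong[where f = exp]) (simp add: field_simps power2_eq_square)
    finally have th: "theta_const (1/5) (k/5) (\<i> * of_real t) =
        A t 0 + A t 0 * of_real (exp (- 4 * pi * t / 5)) * exp (- (pi * \<i> * k / 5)) + infsum (A t) (- {0, -1})" .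
    have B: "infsum (B t) (- {0, -1}) = infsum (A t) (- {0, -1}) / (A t 0 * of_real (exp (- 4 * pi * t / 5)))"
      unfolding B_def[abs_def] divide_inverse by (rule infsum_cmult_left')
    have "w + S / (a * e) = ((a + a * e * w + S) / a - 1) / e" if "a \<noteq> 0" "e \<noteq> 0" for a e w S :: complex
      using that by (simp add: field_simps)
    then show ?case
      unfolding th B using nz by simp
  qed
  ultimately show ?thesis unfolding add_0_right by (rule Lim_transform_eventually)
qed

text \<open>This keeps the quotient identity from degenerating to 0 = 0. If the denominator vanished
  on the whole imaginary axis, its first coefficient after the cancelled leading terms would be 0,
  but the imaginary part of that coefficient is positive.\<close>

lemma denominator_nonzero:
  "\<exists>\<tau>. Im \<tau> > 0 \<and>
    exp (- (pi * \<i> / 5)) * theta_const (1/5) (3/5) \<tau> * theta_const (1/5) (7/5) \<tau> ^ 2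
    - theta_const (1/5) (1/5) \<tau> ^ 2 * theta_const (1/5) (5/5) \<tau> \<noteq> 0"
proof (rule ccontr)
  assume contr: "\<not> ?thesis"
  define \<epsilon> where "\<epsilon> t = complex_of_real (exp (- 4 * pi * t / 5))" for t
  define A where "A k t = theta_term (1/5) (k/5) (\<i> * of_real t) 0" for k t
  define E where "E k t = (theta_const (1/5) (k/5) (\<i> * of_real t) / A k t - 1) / \<epsilon> t" for k t
  define w where "w k = exp (- (pi * \<i> * of_real k / 5))" for k
  \<comment> \<open>The leading terms of the denominator cancel as t tends to infinity; G is what remains after
    dividing by the next order.\<close>
  define G where "G t = E 3 t + 2 * E 7 t - 2 * E 1 t - E 5 t
    + \<epsilon> t * (2 * E 3 t * E 7 t + E 7 t ^ 2 - E 1 t ^ 2 - 2 * E 1 t * E 5 t)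
    + \<epsilon> t ^ 2 * (E 3 t * E 7 t ^ 2 - E 1 t ^ 2 * E 5 t)" for t
  have E: "(E k \<longlongrightarrow> w k) at_top" for k
    unfolding E_def A_def \<epsilon>_def w_def by (rule theta_const_expansion)
  have "((\<lambda>t. exp (- 4 * pi * t / 5)) \<longlongrightarrow> 0) at_top"
    using exp_linear_tendsto_0[of "- 4 * pi / 5"] by simp
  then have \<epsilon>: "(\<epsilon> \<longlongrightarrow> 0) at_top"
    unfolding \<epsilon>_def using tendsto_of_real by fastforce
  have "(G \<longlongrightarrow> w 3 + 2 * w 7 - 2 * w 1 - w 5
    + 0 * (2 * w 3 * w 7 + w 7 ^ 2 - w 1 ^ 2 - 2 * w 1 * w 5)
    + 0 ^ 2 * (w 3 * w 7 ^ 2 - w 1 ^ 2 * w 5)) at_top"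
    unfolding G_def by (intro tendsto_intros E \<epsilon>)
  moreover have "\<forall>\<^sub>F t in at_top. G t = 0"
    using eventually_gt_at_top[of 0]
  proof eventually_elim
    case (elim t)
    have \<epsilon>0: "\<epsilon> t \<noteq> 0" by (simp add: \<epsilon>_def)
    have A0: "A k t \<noteq> 0" for k by (simp add: A_def theta_term_def)
    have th: "theta_const (1/5) (k/5) (\<i> * of_real t) = A k t * (1 + \<epsilon> t * E k t)" for k
      using \<epsilon>0 A0[of k] by (simp add: E_def)
    \<comment> \<open>The terms n = 0 have phases exp(\<pi> i k/50). Since 3 + 7 + 7 exceeds 1 + 1 +
      5 by 10, the discrepancy is exp(\<pi> i/5), which \<kappa> compensates.\<close>
    have A: "exp (- (pi * \<i> / 5)) * A 3 t * A 7 t ^ 2 = A 1 t ^ 2 * A 5 t"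
      unfolding A_def theta_term_def power2_eq_square[of "exp _"] exp_add[symmetric]
      by (rule arg_cong[where f = exp]) (simp add: field_simps)
    have "exp (- (pi * \<i> / 5)) * (A 3 t * (1 + \<epsilon> t * E 3 t)) * (A 7 t * (1 + \<epsilon> t * E 7 t)) ^ 2
        - (A 1 t * (1 + \<epsilon> t * E 1 t)) ^ 2 * (A 5 t * (1 + \<epsilon> t * E 5 t)) = 0"
      unfolding th[symmetric] using contr elim by auto
    \<comment> \<open>With the common leading factor taken out, the difference of the two products
      of factors 1 + \<epsilon> E is exactly \<epsilon> G.\<close>
    then have "A 1 t ^ 2 * A 5 t * \<epsilon> t * G t = 0"
      using A unfolding G_def by algebra
    then show ?case using \<epsilon>0 A0 by simp
  qed
  then have "(G \<longlongrightarrow> 0) at_top" by (rule tendsto_eventually)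
  ultimately have "w 3 + 2 * w 7 - 2 * w 1 - w 5 = 0"
    using tendsto_unique[OF trivial_limit_at_top_linorder] by fastforce
  moreover have "Im (w k) = - sin (pi * k / 5)" for k
    by (simp add: w_def Im_exp)
  \<comment> \<open>This is the imaginary part. It reduces to sin(2\<pi>/5) + 2 sin(\<pi>/5), a sum
    of positive numbers.\<close>
  ultimately have "- sin (pi * 3 / 5) - 2 * sin (pi * 7 / 5) + 2 * sin (pi / 5) + sin pi = 0"
    by (auto simp: complex_eq_iff)
  moreover have "sin (pi * 3 / 5) = sin (2 * pi / 5)" "sin (pi * 7 / 5) = - sin (2 * pi / 5)"
    using sin_pi_minus[of "2 * pi / 5"] sin_periodic_pi[of "2 * pi / 5"] by (simp_all add: field_simps)
  moreover have "sin (2 * pi / 5) > 0" "sin (pi / 5) > 0"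
    by (rule sin_gt_zero; simp)+
  ultimately show False by simp
qed

section \<open>Encoding as polynomials and conclusion\<close>

text \<open>The index j separates the monomials and both coefficients are nonzero, so the support is
  exactly {\<open>m\<^sub>1\<close>, \<open>m\<^sub>2\<close>} and \<open>poly_eval\<close> is a sum
  of two terms.\<close>

lemma poly_with_two_monomials:
  fixes m\<^sub>1 m\<^sub>2 :: "'i \<Rightarrow> nat" and a b :: complex
  assumes "m\<^sub>1 j \<noteq> m\<^sub>2 j" "a \<noteq> 0" "b \<noteq> 0" "\<And>k. k \<notin> K \<Longrightarrow> m\<^sub>1 k = 0 \<and> m\<^sub>2 k = 0"
  shows "\<exists>c. is_poly_in K c \<and>
    (\<forall>x. poly_eval K c x = a * (\<Prod>k\<in>K. x k ^ m\<^sub>1 k) + b * (\<Prod>k\<in>K. x k ^ m\<^sub>2 k))"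
proof -
  define c where "c = (\<lambda>m. if m = m\<^sub>1 then a else if m = m\<^sub>2 then b else 0)"
  have neq: "m\<^sub>1 \<noteq> m\<^sub>2" using assms(1) by blast
  have supp: "{m. c m \<noteq> 0} = {m\<^sub>1, m\<^sub>2}" using assms(2,3) by (auto simp: c_def)
  then have "is_poly_in K c"
    using assms(4) unfolding is_poly_in_def by (auto simp: c_def split: if_splits)
  moreover have "poly_eval K c x = a * (\<Prod>k\<in>K. x k ^ m\<^sub>1 k) + b * (\<Prod>k\<in>K. x k ^ m\<^sub>2 k)" for x
    unfolding poly_eval_def supp using neq by (simp add: c_def)
  ultimately show ?thesis by blast
qed

theorem theorem4p1:
  shows "\<exists>K P Q.
     K \<subseteq> {1, 3, 5, 7, 9 :: nat} \<and> card K = 4 \<and>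
     is_poly_in K P \<and> is_poly_in K Q \<and>
     (\<exists>\<tau>\<in>upper_half_plane.
        poly_eval K Q (\<lambda>k. theta_const (1/5) (real k / 5) \<tau>) \<noteq> 0) \<and>
     (\<forall>\<tau>\<in>upper_half_plane.
        theta_const 1 (1/5) \<tau> * poly_eval K Q (\<lambda>k. theta_const (1/5) (real k / 5) \<tau>)
        = theta_const 1 (3/5) \<tau> * poly_eval K P (\<lambda>k. theta_const (1/5) (real k / 5) \<tau>))"
proof -
  \<comment> \<open>The index 9 is absent because the value at 9/5 was eliminated.\<close>
  define K :: "nat set" where "K = {1, 3, 5, 7}"
  define \<kappa> where "\<kappa> = exp (- (pi * \<i> / 5))"
  have "\<kappa> \<noteq> 0" by (simp add: \<kappa>_def)
  have prod_K: "(\<Prod>k\<in>K. h k) = h 1 * (h 3 * (h 5 * h 7))" for h :: "nat \<Rightarrow> complex"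
    by (simp add: K_def)
  have "\<exists>P. is_poly_in K P \<and> (\<forall>x. poly_eval K P x = \<kappa> * (\<Prod>k\<in>K. x k ^ ((\<lambda>_. 0)(5 := 2, 7 := 1)) k) +
      (- 1) * (\<Prod>k\<in>K. x k ^ ((\<lambda>_. 0)(1 := 1, 3 := 2)) k))"
    \<comment> \<open>The variable of index 7 occurs in the first monomial only.\<close>
    by (rule poly_with_two_monomials[where j = 7]) (use \<open>\<kappa> \<noteq> 0\<close> in \<open>simp_all add: K_def\<close>)
  then obtain P where P: "is_poly_in K P" "\<And>x. poly_eval K P x = \<kappa> * x 5 ^ 2 * x 7 - x 1 * x 3 ^ 2"
    unfolding prod_K by (auto simp: mult.assoc)
  have "\<exists>Q. is_poly_in K Q \<and> (\<forall>x. poly_eval K Q x = \<kappa> * (\<Prod>k\<in>K. x k ^ ((\<lambda>_. 0)(3 := 1, 7 := 2)) k) +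
      (- 1) * (\<Prod>k\<in>K. x k ^ ((\<lambda>_. 0)(1 := 2, 5 := 1)) k))"
    by (rule poly_with_two_monomials[where j = 7]) (use \<open>\<kappa> \<noteq> 0\<close> in \<open>simp_all add: K_def\<close>)
  then obtain Q where Q: "is_poly_in K Q" "\<And>x. poly_eval K Q x = \<kappa> * x 3 * x 7 ^ 2 - x 1 ^ 2 * x 5"
    unfolding prod_K by (auto simp: mult.assoc)
  show ?thesis
  proof (rule exI[of _ K], rule exI[of _ P], rule exI[of _ Q], intro conjI ballI P(1) Q(1))
    show "\<exists>\<tau>\<in>upper_half_plane. poly_eval K Q (\<lambda>k. theta_const (1/5) (real k / 5) \<tau>) \<noteq> 0"
      using denominator_nonzero unfolding Q(2) \<kappa>_def upper_half_plane_def by simp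
    show "theta_const 1 (1/5) \<tau> * poly_eval K Q (\<lambda>k. theta_const (1/5) (real k / 5) \<tau>)
        = theta_const 1 (3/5) \<tau> * poly_eval K P (\<lambda>k. theta_const (1/5) (real k / 5) \<tau>)"
      if "\<tau> \<in> upper_half_plane" for \<tau>
      using theta_const_quotient_relation[of \<tau>] that
      unfolding P(2) Q(2) \<kappa>_def upper_half_plane_def by simp
  qed (auto simp: K_def)
qed

end
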